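(* Let $h:\mathbb R^n\to\mathbb R$ be convex and continuously differentiable with $L_h$-Lipschitz continuous gradient, and assume that $\phi_h(x):=f(x)-h(x)+\frac{\sigma}{2}\|Ax-b\|^2$ is convex on $\mathbb R^n$. Assume $Q\succ0$ and $P-A^\top Q^{-1}A\succ0$. Let $w^k=(x^k,y^k)$ and $\hat w^k=(\hat x^k,\hat y^k):=\widehat{\mathcal T}_{\rm lin}(w^k)$. Then $(\hat x^k,\hat y^k)$ is characterized by $$\hat x^k\in\arg\min_x\Bigl\{f(x)+g(x)-h(x)+\langle\nabla h(x^k),x-x^k\rangle-\langle y^k,Ax-b\rangle+\tfrac\sigma2\|Ax-b\|^2+\tfrac12\|x-x^k\|_P^2\Bigr\},$$ $$\hat y^k=y^k+Q^{-1}\bigl(b-A(2\hat x^k-x^k)\bigr).$$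
   Context: Setting: $A\in\mathbb R^{m\times n}$, $b\in\mathbb R^m$, $\sigma\ge0$; $f:\mathbb R^n\to\mathbb R$ is convex and continuously differentiable with Lipschitz continuous gradient; $g:\mathbb R^n\to(-\infty,+\infty]$ is proper, closed and convex; $P\in\mathbb R^{n\times n}$, $Q\in\mathbb R^{m\times m}$ are self-adjoint; $\|u\|_P^2=\langle u,Pu\rangle$. Define $$\mathcal M=\begin{pmatrix} P & A^\top \\ A & Q \end{pmatrix},\qquad \mathcal B_h(x,y)=\begin{pmatrix} \nabla h(x) \\ 0 \end{pmatrix},$$ $$\mathcal A_h(x,y)=\begin{pmatrix} \partial g(x)+\nabla f(x)-\nabla h(x)-A^\top y+\sigma A^\top(Ax-b) \\ Ax-b \end{pmatrix}.$$ Under the assumptions of the claim, $\mathcal M\succ0$ and the preconditioned forward–backward splitting map $\widehat{\mathcal T}_{\rm lin}(w):=(\mathcal M+\mathcal A_h)^{-1}(\mathcal Mw-\mathcal B_h(w))$ is single-valued and everywhere defined. *)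

theory Defs
  imports "HOL-Analysis.Analysis"
begin

text \<open>Only meaningful at points where \<open>f\<close> is differentiable; this is part of
  \<open>C1_lipschitz_gradient\<close> below.\<close>

definition gradient :: "('a::real_inner \<Rightarrow> real) \<Rightarrow> 'a \<Rightarrow> 'a" where
  "gradient f x = (THE d. GDERIV f x :> d)"

definition C1_lipschitz_gradient :: "real \<Rightarrow> ('a::real_inner \<Rightarrow> real) \<Rightarrow> bool" where
  "C1_lipschitz_gradient L f \<longleftrightarrow>
     (\<forall>x. f differentiable (at x)) \<and> continuous_on UNIV (gradient f) \<and>
     L-lipschitz_on UNIV (gradient f)"

text \<open>The library notions \<open>epigraph\<close> and \<open>convex_on\<close> are restricted to real-valued functions,
  so convexity and closedness of an extended-real-valued function are defined through its
  epigraph as a subset of the space times the reals.\<close>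

definition ereal_epigraph :: "('a \<Rightarrow> ereal) \<Rightarrow> ('a \<times> real) set" where
  "ereal_epigraph g = {(x, r). g x \<le> ereal r}"

definition proper_fun :: "('a \<Rightarrow> ereal) \<Rightarrow> bool" where
  "proper_fun g \<longleftrightarrow> (\<forall>x. g x \<noteq> -\<infinity>) \<and> (\<exists>x. g x \<noteq> \<infinity>)"

definition closed_fun :: "('a::topological_space \<Rightarrow> ereal) \<Rightarrow> bool" where
  "closed_fun g \<longleftrightarrow> closed (ereal_epigraph g)"

definition convex_fun :: "('a::real_vector \<Rightarrow> ereal) \<Rightarrow> bool" where
  "convex_fun g \<longleftrightarrow> convex (ereal_epigraph g)"

text \<open>For proper \<open>g\<close> the subdifferential is empty outside the effective domain of \<open>g\<close>.\<close>

definition subdifferential :: "('a::real_inner \<Rightarrow> ereal) \<Rightarrow> 'a \<Rightarrow> 'a set" where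
  "subdifferential g x = {v. \<forall>z. g x + ereal (v \<bullet> (z - x)) \<le> g z}"

definition pos_def :: "real^'n^'n \<Rightarrow> bool" where
  "pos_def S \<longleftrightarrow> transpose S = S \<and> (\<forall>u. u \<noteq> 0 \<longrightarrow> 0 < u \<bullet> (S *v u))"

definition sq_norm_wrt :: "real^'n^'n \<Rightarrow> real^'n \<Rightarrow> real" where
  "sq_norm_wrt P u = u \<bullet> (P *v u)"

text \<open>The block operators act on pairs \<open>w = (x, y)\<close>; set-valued operators are functions
  into sets.\<close>

definition M_op ::
  "real^'n^'n \<Rightarrow> real^'m^'m \<Rightarrow> real^'n^'m \<Rightarrow> (real^'n) \<times> (real^'m) \<Rightarrow> (real^'n) \<times> (real^'m)"
where
  "M_op P Q A = (\<lambda>(x, y). (P *v x + transpose A *v y, A *v x + Q *v y))"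

definition B_op ::
  "(real^'n \<Rightarrow> real) \<Rightarrow> (real^'n) \<times> (real^'m) \<Rightarrow> (real^'n) \<times> (real^'m)"
where
  "B_op h = (\<lambda>(x, y). (gradient h x, 0))"

definition A_op ::
  "(real^'n \<Rightarrow> real) \<Rightarrow> (real^'n \<Rightarrow> ereal) \<Rightarrow> (real^'n \<Rightarrow> real) \<Rightarrow> real^'n^'m \<Rightarrow> real^'m \<Rightarrow> real \<Rightarrow>
   (real^'n) \<times> (real^'m) \<Rightarrow> ((real^'n) \<times> (real^'m)) set"
where
  "A_op f g h A b \<sigma> = (\<lambda>(x, y).
     {(v + gradient f x - gradient h x - transpose A *v y
         + \<sigma> *\<^sub>R (transpose A *v (A *v x - b)), A *v x - b) | v. v \<in> subdifferential g x})"

definition set_valued_inverse :: "('a \<Rightarrow> 'b set) \<Rightarrow> 'b \<Rightarrow> 'a set" where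
  "set_valued_inverse T u = {w. u \<in> T w}"

definition T_lin_set ::
  "(real^'n \<Rightarrow> real) \<Rightarrow> (real^'n \<Rightarrow> ereal) \<Rightarrow> (real^'n \<Rightarrow> real) \<Rightarrow> real^'n^'m \<Rightarrow> real^'m \<Rightarrow> real \<Rightarrow>
   real^'n^'n \<Rightarrow> real^'m^'m \<Rightarrow> (real^'n) \<times> (real^'m) \<Rightarrow> ((real^'n) \<times> (real^'m)) set"
where
  "T_lin_set f g h A b \<sigma> P Q w =
     set_valued_inverse (\<lambda>w'. {M_op P Q A w' + a | a. a \<in> A_op f g h A b \<sigma> w'})
       (M_op P Q A w - B_op h w)"

definition T_lin ::
  "(real^'n \<Rightarrow> real) \<Rightarrow> (real^'n \<Rightarrow> ereal) \<Rightarrow> (real^'n \<Rightarrow> real) \<Rightarrow> real^'n^'m \<Rightarrow> real^'m \<Rightarrow> real \<Rightarrow>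
   real^'n^'n \<Rightarrow> real^'m^'m \<Rightarrow> (real^'n) \<times> (real^'m) \<Rightarrow> (real^'n) \<times> (real^'m)"
where
  "T_lin f g h A b \<sigma> P Q w = (THE w'. w' \<in> T_lin_set f g h A b \<sigma> P Q w)"

end

theory Submission
  imports Defs
begin

text \<open>The first block row of the inclusion \<open>M w - B w \<in> M w' + A w'\<close> does not involve \<open>y'\<close>,
  because the two terms \<open>A\<^sup>T y'\<close> cancel; it is Fermat's rule for the subproblem in \<open>x\<close>. The second
  row then determines \<open>y'\<close> from \<open>x'\<close>. Since \<open>P - A\<^sup>T Q\<^sup>-\<^sup>1 A\<close> and \<open>Q\<close> are positive definite, so
  is \<open>P\<close>; hence the smooth part of the subproblem is strongly convex and the subproblem has exactly
  one solution.\<close>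

section \<open>Gradients and the gradient inequality\<close>

text \<open>The vector \<open>adjoint f' 1\<close> represents the derivative \<open>f'\<close>, and
  a gradient is unique, so the definite description in \<open>gradient\<close> denotes it.\<close>

lemma differentiable_GDERIV_gradient:
  fixes f :: "'a::euclidean_space \<Rightarrow> real"
  assumes "f differentiable (at x)"
  shows "GDERIV f x :> gradient f x"
proof -
  obtain f' where f': "(f has_derivative f') (at x)"
    using assms unfolding differentiable_def by blast
  then have "linear f'"
    by (rule has_derivative_linear)
  then have "f' = (\<lambda>u. u \<bullet> adjoint f' 1)"
    using adjoint_works[OF \<open>linear f'\<close>, of _ 1] by (simp add: fun_eq_iff)
  with f' have "GDERIV f x :> adjoint f' 1"
    by (simp add: gderiv_def)
  moreover have "d = d'" if "GDERIV f x :> d" "GDERIV f x :> d'" for d d'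
    using has_derivative_unique[OF that[unfolded gderiv_def]]
    by (metis vector_eq_ldot)
  ultimately show ?thesis
    unfolding gradient_def by (metis theI)
qed

text \<open>The bound \<open>K\<close> on the difference quotients along \<open>u\<close> survives
  the one-sided limit at 0. This serves both the gradient inequality and Fermat's rule.\<close>

lemma GDERIV_directional_ge:
  fixes \<psi> :: "'a::real_inner \<Rightarrow> real"
  assumes "GDERIV \<psi> x :> d"
    and ge: "\<And>t. 0 < t \<Longrightarrow> t < 1 \<Longrightarrow> t * K \<le> \<psi> (x + t *\<^sub>R u) - \<psi> x"
  shows "K \<le> d \<bullet> u"
proof -
  have "((\<lambda>t. x + t *\<^sub>R u) has_derivative (\<lambda>t. t *\<^sub>R u)) (at 0)"
    by (auto intro!: derivative_eq_intros)
  moreover have "(\<psi> has_derivative (\<lambda>v. v \<bullet> d)) (at (x + 0 *\<^sub>R u))"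
    using assms(1) by (simp add: gderiv_def)
  ultimately have "((\<lambda>t. \<psi> (x + t *\<^sub>R u)) has_derivative (\<lambda>t. (t *\<^sub>R u) \<bullet> d)) (at 0)"
    by (rule has_derivative_compose)
  then have "((\<lambda>t. \<psi> (x + t *\<^sub>R u)) has_field_derivative (d \<bullet> u)) (at 0)"
    by (simp add: has_field_derivative_def inner_commute mult.commute[of _ "d \<bullet> u"])
  then have "((\<lambda>t. (\<psi> (x + t *\<^sub>R u) - \<psi> x) / t) \<longlongrightarrow> d \<bullet> u) (at_right 0)"
    by (simp add: has_field_derivative_iff filterlim_at_split)
  moreover have "\<forall>\<^sub>F t in at_right 0. K \<le> (\<psi> (x + t *\<^sub>R u) - \<psi> x) / t"
    using ge by (auto simp: eventually_at_right_field field_simps intro!: exI[of _ 1])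
  ultimately show ?thesis
    by (rule tendsto_lowerbound) simp
qed

lemma convex_on_above_gradient:
  fixes \<psi> :: "'a::real_inner \<Rightarrow> real"
  assumes "convex_on UNIV \<psi>" "GDERIV \<psi> x :> d"
  shows "\<psi> x + d \<bullet> (z - x) \<le> \<psi> z"
proof -
  \<comment> \<open>Convexity bounds \<psi> from above along the segment, so the directional
    estimate is applied to the negative of \<psi>.\<close>
  have "\<psi> x - \<psi> z \<le> - d \<bullet> (z - x)"
  proof (rule GDERIV_directional_ge)
    show "GDERIV (\<lambda>x. - \<psi> x) x :> - d"
      by (rule GDERIV_minus) fact
    fix t :: real assume "0 < t" "t < 1"
    then have "\<psi> ((1 - t) *\<^sub>R x + t *\<^sub>R z) \<le> (1 - t) * \<psi> x + t * \<psi> z"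
      using assms(1) by (intro convex_onD) auto
    then show "t * (\<psi> x - \<psi> z) \<le> - \<psi> (x + t *\<^sub>R (z - x)) - - \<psi> x"
      by (simp add: algebra_simps)
  qed
  then show ?thesis by simp
qed

section \<open>Extended-real-valued convex functions and subgradients\<close>

lemma convex_fun_le:
  assumes "convex_fun g" "g x \<le> ereal r" "g z \<le> ereal s" "0 \<le> t" "t \<le> 1"
  shows "g ((1 - t) *\<^sub>R x + t *\<^sub>R z) \<le> ereal ((1 - t) * r + t * s)"
  using convexD_alt[of "ereal_epigraph g" "(x, r)" "(z, s)" t] assms
  by (simp add: convex_fun_def ereal_epigraph_def)

lemma proper_fun_subdifferential_finite:
  assumes "proper_fun g" "v \<in> subdifferential g x"
  obtains r where "g x = ereal r"
proof -
  obtain z where "g z \<noteq> \<infinity>"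
    using assms(1) by (auto simp: proper_fun_def)
  moreover have "g x + ereal (v \<bullet> (z - x)) \<le> g z"
    using assms(2) by (simp add: subdifferential_def)
  ultimately have "g x \<noteq> \<infinity>" by auto
  with assms(1) that show ?thesis
    by (cases "g x") (auto simp: proper_fun_def)
qed

text \<open>A hyperplane separates the epigraph from a point strictly below it. It is not vertical:
  \<open>(x0, r0)\<close> lies in the epigraph directly above that point, which forces
  \<open>0 < s\<close>. Solving for the last coordinate gives the minorant.\<close>

lemma closed_convex_affine_minorant:
  fixes g :: "'a::euclidean_space \<Rightarrow> ereal"
  assumes "proper_fun g" "closed_fun g" "convex_fun g"
  obtains v \<beta> where "\<And>x r. g x \<le> ereal r \<Longrightarrow> v \<bullet> x + \<beta> \<le> r"
proof -
  obtain x0 r0 where g0: "g x0 = ereal r0"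
    using assms(1) unfolding proper_fun_def by (metis ereal_cases)
  have "(x0, r0 - 1) \<notin> ereal_epigraph g"
    by (simp add: ereal_epigraph_def g0)
  then obtain a \<gamma> where a: "a \<bullet> (x0, r0 - 1) < \<gamma>"
      and sep: "\<And>p. p \<in> ereal_epigraph g \<Longrightarrow> \<gamma> < a \<bullet> p"
    using separating_hyperplane_closed_point[of "ereal_epigraph g" "(x0, r0 - 1)"] assms
    unfolding closed_fun_def convex_fun_def by blast
  obtain u s where us: "a = (u, s)" by (cases a)
  have "\<gamma> < u \<bullet> x0 + s * r0"
    using sep[of "(x0, r0)"] by (simp add: ereal_epigraph_def g0 us)
  with a have "0 < s" by (simp add: us algebra_simps)
  have "(- (1 / s) *\<^sub>R u) \<bullet> x + \<gamma> / s \<le> r" if "g x \<le> ereal r" for x r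
  proof -
    have "\<gamma> < u \<bullet> x + s * r"
      using sep[of "(x, r)"] that by (simp add: ereal_epigraph_def us)
    with \<open>0 < s\<close> show ?thesis by (simp add: field_simps)
  qed
  with that show ?thesis by blast
qed

text \<open>Fermat's rule for a smooth term plus \<open>g\<close>. Forwards, \<open>x\<close> is
  compared with points of the segment towards \<open>z\<close>, where convexity bounds
  \<open>g\<close>, and the step length tends to 0. Backwards, the subgradient inequality is added
  to \<open>above\<close>.\<close>

lemma arg_min_iff_subdifferential:
  fixes \<psi> :: "'a::real_inner \<Rightarrow> real"
  assumes "proper_fun g" "convex_fun g" "GDERIV \<psi> x :> d"
    and above: "\<And>z. \<psi> x + d \<bullet> (z - x) \<le> \<psi> z"
  shows "is_arg_min (\<lambda>x. ereal (\<psi> x) + g x) (\<lambda>_. True) x \<longleftrightarrow> - d \<in> subdifferential g x"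
proof
  assume "is_arg_min (\<lambda>x. ereal (\<psi> x) + g x) (\<lambda>_. True) x"
  then have min: "ereal (\<psi> x) + g x \<le> ereal (\<psi> z) + g z" for z
    by (auto simp: is_arg_min_def not_less)
  obtain z0 r0 where "g z0 = ereal r0"
    using assms(1) unfolding proper_fun_def by (metis ereal_cases)
  with min[of z0] have "g x \<noteq> \<infinity>" by auto
  then obtain r where r: "g x = ereal r"
    using assms(1) unfolding proper_fun_def by (metis ereal_cases)
  have "g x + ereal (- d \<bullet> (z - x)) \<le> g z" for z
  proof (cases "g z")
    case (real s)
    have "r - s \<le> d \<bullet> (z - x)"
    proof (rule GDERIV_directional_ge[OF assms(3)])
      fix t :: real assume "0 < t" "t < 1"
      then have "g ((1 - t) *\<^sub>R x + t *\<^sub>R z) \<le> ereal ((1 - t) * r + t * s)"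
        using assms(2) r real by (intro convex_fun_le) auto
      then have "g (x + t *\<^sub>R (z - x)) \<le> ereal ((1 - t) * r + t * s)"
        by (simp add: algebra_simps)
      then have "ereal (\<psi> (x + t *\<^sub>R (z - x))) + g (x + t *\<^sub>R (z - x))
          \<le> ereal (\<psi> (x + t *\<^sub>R (z - x))) + ereal ((1 - t) * r + t * s)"
        by (rule add_left_mono)
      with min[of "x + t *\<^sub>R (z - x)"]
      have "ereal (\<psi> x) + ereal r \<le> ereal (\<psi> (x + t *\<^sub>R (z - x))) + ereal ((1 - t) * r + t * s)"
        unfolding r by (rule order_trans)
      then show "t * (r - s) \<le> \<psi> (x + t *\<^sub>R (z - x)) - \<psi> x"
        by (simp add: algebra_simps)
    qed
    with r real show ?thesis by simp
  qed (use assms(1) in \<open>auto simp: proper_fun_def\<close>)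
  then show "- d \<in> subdifferential g x"
    by (simp add: subdifferential_def)
next
  assume sub: "- d \<in> subdifferential g x"
  with assms(1) obtain r where r: "g x = ereal r"
    by (rule proper_fun_subdifferential_finite)
  have "ereal (\<psi> x) + g x \<le> ereal (\<psi> z) + g z" for z
  proof -
    have "g x + ereal (- d \<bullet> (z - x)) \<le> g z"
      using sub by (simp add: subdifferential_def)
    with above[of z] r show ?thesis by (cases "g z") auto
  qed
  then show "is_arg_min (\<lambda>x. ereal (\<psi> x) + g x) (\<lambda>_. True) x"
    by (auto simp: is_arg_min_def not_less)
qed

section \<open>Existence and uniqueness for strongly convex problems\<close>

text \<open>Instead of \<open>\<psi> + g\<close>, the continuous real function
  \<open>\<psi> x + r\<close> is minimised over pairs in the epigraph, so that lower semicontinuity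
  of \<open>g\<close> enters as closedness of a set. The sublevel set \<open>S\<close> is compact
  because the quadratic growth of \<psi> beats the affine minorant of \<open>g\<close>.\<close>

lemma strongly_convex_ex_arg_min:
  fixes \<psi> :: "'a::euclidean_space \<Rightarrow> real"
  assumes g: "proper_fun g" "closed_fun g" "convex_fun g"
    and cont: "continuous_on UNIV \<psi>" and "0 < c"
    and strong: "\<And>z. \<psi> x0 + d \<bullet> (z - x0) + c * (norm (z - x0))\<^sup>2 \<le> \<psi> z"
  shows "\<exists>x. is_arg_min (\<lambda>x. ereal (\<psi> x) + g x) (\<lambda>_. True) x"
proof -
  obtain v \<beta> where minorant: "\<And>x r. g x \<le> ereal r \<Longrightarrow> v \<bullet> x + \<beta> \<le> r"
    using closed_convex_affine_minorant[OF g] by blast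
  obtain z0 r0 where g0: "g z0 = ereal r0"
    using g(1) unfolding proper_fun_def by (metis ereal_cases)
  define S where "S = ereal_epigraph g \<inter> {p. \<psi> (fst p) + snd p \<le> \<psi> z0 + r0}"
  have contF: "continuous_on X (\<lambda>p. \<psi> (fst p) + snd p)" for X :: "('a \<times> real) set"
    by (intro continuous_intros continuous_on_compose2[OF cont]) auto
  have "closed S"
    unfolding S_def using g(2) contF
    by (intro closed_Int closed_Collect_le) (auto simp: closed_fun_def intro!: continuous_intros)
  moreover have "bounded S"
  proof -
    \<comment> \<open>On \<open>S\<close>, the growth bound, the minorant and the level bound
      combine to \<open>c * n\<^sup>2 \<le> \<bar>C\<bar> + M * n\<close> with
      \<open>n = norm (x - x0)\<close>. Beyond \<open>R\<close> this fails: the quotient in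
      \<open>R\<close> yields \<open>M + \<bar>C\<bar> < c * n\<close>, and the summand 1 yields
      \<open>1 < n\<close>, hence \<open>\<bar>C\<bar> \<le> \<bar>C\<bar> * n\<close>.\<close>
    define M where "M = norm (d + v)"
    define C where "C = \<psi> z0 + r0 - \<psi> x0 - v \<bullet> x0 - \<beta>"
    define R where "R = (M + \<bar>C\<bar>) / c + 1"
    have dist_le: "norm (x - x0) \<le> R" if "(x, r) \<in> S" for x r
    proof (rule ccontr)
      assume "\<not> norm (x - x0) \<le> R"
      moreover define n where "n = norm (x - x0)"
      ultimately have n: "R < n" by simp
      have "v \<bullet> x + \<beta> \<le> r" "\<psi> x + r \<le> \<psi> z0 + r0"
        using that minorant by (auto simp: S_def ereal_epigraph_def)
      with strong[of x] have "c * n\<^sup>2 \<le> C - (d + v) \<bullet> (x - x0)"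
        by (simp add: C_def n_def algebra_simps)
      also have "\<dots> \<le> \<bar>C\<bar> + M * n"
        using Cauchy_Schwarz_ineq2[of "d + v" "x - x0"] by (simp add: M_def n_def)
      finally have le: "c * n\<^sup>2 \<le> \<bar>C\<bar> + M * n" .
      have "0 \<le> M" by (simp add: M_def)
      then have "1 \<le> R" using \<open>0 < c\<close> by (simp add: R_def)
      with n have "1 < n" by simp
      have "M + \<bar>C\<bar> < c * n"
        using n \<open>0 < c\<close> by (simp add: R_def field_simps)
      then have "(M + \<bar>C\<bar>) * n < c * n * n"
        using \<open>1 < n\<close> by (intro mult_strict_right_mono) auto
      moreover have "\<bar>C\<bar> * 1 \<le> \<bar>C\<bar> * n"
        using \<open>1 < n\<close> by (intro mult_left_mono) auto
      ultimately show False using le by (simp add: power2_eq_square algebra_simps)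
    qed
    have "compact (\<psi> ` cball x0 R)"
      by (intro compact_continuous_image continuous_on_subset[OF cont]) auto
    then obtain B where B: "\<And>x. x \<in> cball x0 R \<Longrightarrow> \<bar>\<psi> x\<bar> \<le> B"
      using compact_imp_bounded by (metis bounded_real imageI)
    \<comment> \<open>The height \<open>r\<close> is bounded below by the minorant and above by the
      level, as \<psi> is bounded on the ball.\<close>
    have "S \<subseteq> cball x0 R \<times> {- norm v * (norm x0 + R) + \<beta> .. \<psi> z0 + r0 + B}"
    proof clarify
      fix x r assume xr: "(x, r) \<in> S"
      then have x: "norm (x - x0) \<le> R" by (rule dist_le)
      then have "x \<in> cball x0 R" by (simp add: dist_norm norm_minus_commute)
      moreover have "v \<bullet> x + \<beta> \<le> r" "\<psi> x + r \<le> \<psi> z0 + r0"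
        using xr minorant by (auto simp: S_def ereal_epigraph_def)
      moreover have "norm x \<le> norm x0 + R"
        using x norm_triangle_sub[of x x0] by simp
      then have "norm v * norm x \<le> norm v * (norm x0 + R)"
        by (intro mult_left_mono) auto
      then have "- norm v * (norm x0 + R) \<le> v \<bullet> x"
        using Cauchy_Schwarz_ineq2[of v x] by simp
      ultimately show "x \<in> cball x0 R \<and> r \<in> {- norm v * (norm x0 + R) + \<beta> .. \<psi> z0 + r0 + B}"
        using B[of x] by auto
    qed
    then show ?thesis
      by (rule bounded_subset[rotated]) (intro bounded_Times bounded_cball bounded_closed_interval)
  qed
  ultimately have "compact S" by (simp add: compact_eq_bounded_closed)
  moreover have "(z0, r0) \<in> S" by (simp add: S_def ereal_epigraph_def g0)
  ultimately obtain x r where xr: "(x, r) \<in> S"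
      and min: "\<And>z s. (z, s) \<in> S \<Longrightarrow> \<psi> x + r \<le> \<psi> z + s"
    using continuous_attains_inf[OF _ _ contF[of S]] by fastforce
  have "ereal (\<psi> x) + g x \<le> ereal (\<psi> z) + g z" for z
  proof (cases "g z")
    case (real s)
    have "\<psi> x + r \<le> \<psi> z + s"
    proof (cases "(z, s) \<in> S")
      \<comment> \<open>A point of the epigraph outside \<open>S\<close> exceeds the level
        \<open>\<psi> z0 + r0\<close>, which \<open>(x, r)\<close> respects.\<close>
      case False
      with real xr show ?thesis by (auto simp: S_def ereal_epigraph_def)
    qed (rule min)
    moreover have "ereal (\<psi> x) + g x \<le> ereal (\<psi> x) + ereal r"
      using xr by (intro add_left_mono) (simp add: S_def ereal_epigraph_def)
    ultimately show ?thesis using real by (auto intro: order_trans)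
  qed (use g(1) in \<open>auto simp: proper_fun_def\<close>)
  then show ?thesis by (auto simp: is_arg_min_def not_less)
qed

lemma strongly_convex_ex1_subdifferential:
  fixes \<psi> :: "'a::euclidean_space \<Rightarrow> real"
  assumes g: "proper_fun g" "closed_fun g" "convex_fun g"
    and grad: "\<And>x. GDERIV \<psi> x :> D x" and "0 < c"
    and strong: "\<And>x z. \<psi> x + D x \<bullet> (z - x) + c * (norm (z - x))\<^sup>2 \<le> \<psi> z"
  shows "\<exists>!x. - D x \<in> subdifferential g x"
proof -
  have above: "\<psi> x + D x \<bullet> (z - x) \<le> \<psi> z" for x z
    using strong[of x z] \<open>0 < c\<close> zero_le_power2[of "norm (z - x)"]
    by (smt (verit) mult_nonneg_nonneg)
  have "continuous_on UNIV \<psi>"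
    using grad by (auto simp: gderiv_def continuous_on_eq_continuous_at intro: has_derivative_continuous)
  then have "\<exists>x. - D x \<in> subdifferential g x"
    using strongly_convex_ex_arg_min[OF g _ \<open>0 < c\<close> strong]
      arg_min_iff_subdifferential[OF g(1,3) grad above] by blast
  moreover have "x = z" if x: "- D x \<in> subdifferential g x" and z: "- D z \<in> subdifferential g z" for x z
  proof -
    obtain r where r: "g x = ereal r" using proper_fun_subdifferential_finite[OF g(1) x] .
    obtain s where s: "g z = ereal s" using proper_fun_subdifferential_finite[OF g(1) z] .
    have "g x + ereal (- D x \<bullet> (z - x)) \<le> g z" "g z + ereal (- D z \<bullet> (x - z)) \<le> g x"
      using x z by (simp_all only: subdifferential_def mem_Collect_eq)
    then have "r - D x \<bullet> (z - x) \<le> s" "s - D z \<bullet> (x - z) \<le> r"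
      by (simp_all add: r s)
    \<comment> \<open>In the sum of the two subgradient and the two strong convexity inequalities
      all function values and gradient terms cancel.\<close>
    with strong[of x z] strong[of z x] have "c * (norm (z - x))\<^sup>2 \<le> 0"
      by (simp add: norm_minus_commute)
    then have "(norm (z - x))\<^sup>2 \<le> 0"
      using \<open>0 < c\<close> by (metis mult_le_cancel_left_pos mult_zero_right)
    then show ?thesis by simp
  qed
  ultimately show ?thesis by blast
qed

section \<open>Positive definite matrices\<close>

lemma matrix_inv_inverse:
  assumes "invertible Q"
  shows matrix_inv_left: "matrix_inv Q ** Q = mat 1"
    and matrix_inv_right: "Q ** matrix_inv Q = mat 1"
  using someI_ex[of "\<lambda>Q'. Q ** Q' = mat 1 \<and> Q' ** Q = mat 1"] assms
  by (simp_all add: invertible_def matrix_inv_def)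

lemma pos_def_invertible:
  assumes "pos_def S"
  shows "invertible S"
proof -
  have "u = 0" if "S *v u = 0" for u
    using assms that by (force simp: pos_def_def)
  then show ?thesis
    using matrix_left_invertible_ker[of S] invertible_left_inverse[of S] by blast
qed

text \<open>The constant is the minimum of the quadratic form on the compact unit sphere;
  homogeneity extends the bound to all vectors.\<close>

lemma pos_def_ge_norm_square:
  fixes S :: "real^'n^'n"
  assumes "pos_def S"
  obtains c where "0 < c" "\<And>u. c * (norm u)\<^sup>2 \<le> u \<bullet> (S *v u)"
proof -
  have cont: "continuous_on (sphere 0 1) (\<lambda>u. u \<bullet> (S *v u))"
    by (intro continuous_intros)
  have "sphere (0::real^'n) 1 \<noteq> {}"
    by simp
  then obtain e where e: "e \<in> sphere 0 1" "\<forall>u\<in>sphere 0 1. e \<bullet> (S *v e) \<le> u \<bullet> (S *v u)"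
    using continuous_attains_inf[OF compact_sphere _ cont] by blast
  have "(e \<bullet> (S *v e)) * (norm u)\<^sup>2 \<le> u \<bullet> (S *v u)" for u
  proof (cases "u = 0")
    case False
    define w where "w = (1 / norm u) *\<^sub>R u"
    have "u = norm u *\<^sub>R w" "w \<in> sphere 0 1" using False by (simp_all add: w_def)
    have "u \<bullet> (S *v u) = (norm u)\<^sup>2 * (w \<bullet> (S *v w))"
      by (subst (1 2) \<open>u = norm u *\<^sub>R w\<close>) (simp add: matrix_vector_mult_scaleR power2_eq_square)
    moreover have "e \<bullet> (S *v e) \<le> w \<bullet> (S *v w)"
      using e(2) \<open>w \<in> sphere 0 1\<close> by blast
    ultimately show ?thesis
      by (simp add: mult.commute[of _ "(norm u)\<^sup>2"] mult_left_mono)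
  qed simp
  moreover have "0 < e \<bullet> (S *v e)"
    using assms e(1) unfolding pos_def_def by (metis mem_sphere_0 norm_zero zero_neq_one)
  ultimately show ?thesis using that by blast
qed

text \<open>Substituting \<open>u = Q *v w\<close> turns the form of the inverse into the form of
  \<open>Q\<close> at \<open>w\<close>.\<close>

lemma pos_def_matrix_inv_nonneg:
  assumes "pos_def Q"
  shows "0 \<le> u \<bullet> (matrix_inv Q *v u)"
proof -
  define w where "w = matrix_inv Q *v u"
  have "u = Q *v w"
    using pos_def_invertible[OF assms]
    by (simp add: w_def matrix_vector_mul_assoc matrix_inv_right)
  with assms have "0 \<le> u \<bullet> w"
    by (cases "w = 0") (auto simp: pos_def_def inner_commute less_imp_le)
  then show ?thesis by (simp add: w_def)
qed

text \<open>The adjoint identity, phrased with \<open>y v* A\<close> because the simplifier rewrites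
  \<open>transpose A *v y\<close> to that form.\<close>

lemma inner_vector_matrix_mult: "u \<bullet> (y v* A) = (A *v u) \<bullet> (y::real^'m)"
  by (metis dot_lmul_matrix inner_commute)

text \<open>The form of \<open>P\<close> is the form of the Schur complement plus the form of
  \<open>matrix_inv Q\<close> at \<open>A *v u\<close>: a positive and a nonnegative term.\<close>

lemma pos_def_of_Schur_complement:
  fixes A :: "real^'n^'m"
  assumes "transpose P = P" "pos_def Q" "pos_def (P - transpose A ** matrix_inv Q ** A)"
  shows "pos_def P"
proof -
  have "0 < u \<bullet> (P *v u)" if "u \<noteq> 0" for u
  proof -
    have "0 < u \<bullet> ((P - transpose A ** matrix_inv Q ** A) *v u)"
      using assms(3) that by (simp add: pos_def_def)
    also have "\<dots> = u \<bullet> (P *v u) - (A *v u) \<bullet> (matrix_inv Q *v (A *v u))"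
      by (simp add: matrix_vector_mult_diff_rdistrib inner_diff_right inner_vector_matrix_mult
          flip: matrix_vector_mul_assoc)
    finally show ?thesis
      using pos_def_matrix_inv_nonneg[OF assms(2), of "A *v u"] by simp
  qed
  with assms(1) show ?thesis by (simp add: pos_def_def)
qed

section \<open>Expansion and gradients of the terms of the subproblem\<close>

text \<open>Symmetry merges the two cross terms. The expansion is exact, so its last term supplies
  the strong convexity of the proximal term.\<close>

lemma sq_norm_wrt_add:
  assumes "transpose P = P"
  shows "sq_norm_wrt P (u + v) = sq_norm_wrt P u + 2 * ((P *v u) \<bullet> v) + sq_norm_wrt P v"
proof -
  have "u \<bullet> (P *v v) = v \<bullet> (P *v u)"
    using assms by (metis dot_lmul_matrix inner_commute transpose_matrix_vector)
  then show ?thesis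
    by (simp add: sq_norm_wrt_def matrix_vector_right_distrib inner_left_distrib inner_right_distrib
        inner_commute)
qed

lemma GDERIV_sq_norm_wrt:
  assumes "transpose P = P"
  shows "GDERIV (\<lambda>x. 1 / 2 * sq_norm_wrt P (x - a)) x :> P *v (x - a)"
proof -
  have "u \<bullet> (P *v v) = v \<bullet> (P *v u)" for u v
    using assms by (metis dot_lmul_matrix inner_commute transpose_matrix_vector)
  then show ?thesis
    unfolding gderiv_def sq_norm_wrt_def
    by (auto intro!: derivative_eq_intros bounded_linear.has_derivative[OF matrix_vector_mul_bounded_linear]
        simp: fun_eq_iff algebra_simps)
qed

lemma GDERIV_norm_square_affine:
  fixes A :: "real^'n^'m"
  shows "GDERIV (\<lambda>x. \<sigma> / 2 * (norm (A *v x - b))\<^sup>2) x :> \<sigma> *\<^sub>R (transpose A *v (A *v x - b))"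
  unfolding gderiv_def power2_norm_eq_inner
  by (rule derivative_eq_intros bounded_linear.has_derivative[OF matrix_vector_mul_bounded_linear] refl
      | simp add: fun_eq_iff)+
    (simp add: inner_vector_matrix_mult inner_commute algebra_simps)

lemma GDERIV_linear_terms:
  fixes A :: "real^'n^'m"
  shows "GDERIV (\<lambda>x. p \<bullet> (x - a) - y \<bullet> (A *v x - b)) x :> p - transpose A *v y"
  unfolding gderiv_def
  by (auto intro!: derivative_eq_intros bounded_linear.has_derivative[OF matrix_vector_mul_bounded_linear]
      simp: fun_eq_iff inner_vector_matrix_mult inner_commute algebra_simps)

section \<open>The inclusion defining \<open>T_lin_set\<close>, row by row\<close>

lemma matrix_vector_eq_iff_matrix_inv:
  fixes Q :: "real^'m^'m"
  assumes "invertible Q"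
  shows "Q *v u = v \<longleftrightarrow> u = matrix_inv Q *v v"
  using matrix_inv_left[OF assms] matrix_inv_right[OF assms]
  by (metis matrix_vector_mul_assoc matrix_vector_mul_lid)

text \<open>Stated for groups because on vectors the simplifier turns \<open>p + p\<close> into the componentwise
  product \<open>2 * p\<close>.\<close>

lemma add_add_diff_eq_iff:
  fixes b p p' q q' :: "'a::ab_group_add"
  shows "p + q = p' + q' + (p' - b) \<longleftrightarrow> q' - q = b - (p' + p' - p)"
  by (auto simp: algebra_simps)

lemma T_lin_set_iff:
  fixes A :: "real^'n^'m"
  assumes "invertible Q"
  shows "(x', y') \<in> T_lin_set f g h A b \<sigma> P Q (x, y) \<longleftrightarrow>
    - (gradient f x' - gradient h x' + \<sigma> *\<^sub>R (transpose A *v (A *v x' - b))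
        + (gradient h x - transpose A *v y) + P *v (x' - x)) \<in> subdifferential g x' \<and>
    y' = y + matrix_inv Q *v (b - A *v (2 *\<^sub>R x' - x))"
    (is "_ \<longleftrightarrow> - ?d \<in> _ \<and> _")
proof -
  \<comment> \<open>The factor 2 arises because \<open>A *v x'\<close> occurs both in
    \<open>M_op\<close> and in \<open>A_op\<close>.\<close>
  have row2: "A *v x + Q *v y = A *v x' + Q *v y' + (A *v x' - b) \<longleftrightarrow>
      Q *v (y' - y) = b - A *v (2 *\<^sub>R x' - x)"
    by (simp only: add_add_diff_eq_iff scaleR_2 matrix_vector_mult_diff_distrib matrix_vector_right_distrib)
  have "(x', y') \<in> T_lin_set f g h A b \<sigma> P Q (x, y) \<longleftrightarrow>
      (\<exists>v \<in> subdifferential g x'. P *v x + transpose A *v y - gradient h x =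
        P *v x' + transpose A *v y' + (v + gradient f x' - gradient h x' - transpose A *v y'
          + \<sigma> *\<^sub>R (transpose A *v (A *v x' - b))) \<and>
       A *v x + Q *v y = A *v x' + Q *v y' + (A *v x' - b))"
    unfolding T_lin_set_def set_valued_inverse_def M_op_def A_op_def B_op_def split_conv
      Setcompr_eq_image mem_Collect_eq image_iff
    by (simp only: bex_simps add_Pair diff_Pair diff_zero prod.inject)
  \<comment> \<open>The first row determines the subgradient \<open>v\<close>, so the existential
    quantifier collapses to a membership.\<close>
  also have "\<dots> \<longleftrightarrow> (\<exists>v \<in> subdifferential g x'. v = - ?d \<and> Q *v (y' - y) = b - A *v (2 *\<^sub>R x' - x))"
    unfolding row2 by (intro bex_cong refl arg_cong2[where f = "(\<and>)"])
      (auto simp: matrix_vector_mult_diff_distrib algebra_simps)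
  also have "\<dots> \<longleftrightarrow> - ?d \<in> subdifferential g x' \<and> y' = y + matrix_inv Q *v (b - A *v (2 *\<^sub>R x' - x))"
    unfolding matrix_vector_eq_iff_matrix_inv[OF assms] by (auto simp: diff_eq_eq add.commute)
  finally show ?thesis .
qed

text \<open>Unique existence belongs to the conclusion because \<open>T_lin\<close> is a definite
  description and carries information only together with it.\<close>

theorem proposition6:
  fixes A :: "real^'n^'m" and b :: "real^'m" and \<sigma> L\<^sub>h :: real
    and f h :: "real^'n \<Rightarrow> real" and g :: "real^'n \<Rightarrow> ereal"
    and P :: "real^'n^'n" and Q :: "real^'m^'m"
    and x\<^sub>k x' :: "real^'n" and y\<^sub>k y' :: "real^'m"
  assumes "\<sigma> \<ge> 0"
    and "convex_on UNIV f" and "\<exists>L. C1_lipschitz_gradient L f"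
    and "proper_fun g" and "closed_fun g" and "convex_fun g"
    and "transpose P = P" and "transpose Q = Q"
    and "convex_on UNIV h" and "C1_lipschitz_gradient L\<^sub>h h"
    and "convex_on UNIV (\<lambda>x. f x - h x + \<sigma> / 2 * (norm (A *v x - b))\<^sup>2)"
    and "pos_def Q" and "pos_def (P - transpose A ** matrix_inv Q ** A)"
  shows "(\<exists>!w. w \<in> T_lin_set f g h A b \<sigma> P Q (x\<^sub>k, y\<^sub>k)) \<and>
    ((x', y') = T_lin f g h A b \<sigma> P Q (x\<^sub>k, y\<^sub>k) \<longleftrightarrow>
      is_arg_min
        (\<lambda>x. ereal (f x) + g x - ereal (h x)
              + ereal (gradient h x\<^sub>k \<bullet> (x - x\<^sub>k) - y\<^sub>k \<bullet> (A *v x - b)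
                  + \<sigma> / 2 * (norm (A *v x - b))\<^sup>2 + 1 / 2 * sq_norm_wrt P (x - x\<^sub>k)))
        (\<lambda>_. True) x' \<and>
      y' = y\<^sub>k + matrix_inv Q *v (b - A *v (2 *\<^sub>R x' - x\<^sub>k)))"
proof -
  \<comment> \<open>The smooth part \<psi> is split into \<phi>, convex as a whole by assumption
    although \<open>f - h\<close> may not be, the affine \<open>q\<close> and the proximal
    quadratic.\<close>
  define \<phi> where "\<phi> = (\<lambda>x. f x - h x + \<sigma> / 2 * (norm (A *v x - b))\<^sup>2)"
  define q where "q = (\<lambda>x. gradient h x\<^sub>k \<bullet> (x - x\<^sub>k) - y\<^sub>k \<bullet> (A *v x - b))"
  define \<psi> where "\<psi> = (\<lambda>x. \<phi> x + q x + 1 / 2 * sq_norm_wrt P (x - x\<^sub>k))"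
  define D\<phi> where
    "D\<phi> = (\<lambda>x. gradient f x - gradient h x + \<sigma> *\<^sub>R (transpose A *v (A *v x - b)))"
  define dq where "dq = gradient h x\<^sub>k - transpose A *v y\<^sub>k"
  define D where "D = (\<lambda>x. D\<phi> x + dq + P *v (x - x\<^sub>k))"
  have diff: "GDERIV f x :> gradient f x" "GDERIV h x :> gradient h x" for x
    using assms(3,10) by (auto simp: C1_lipschitz_gradient_def intro: differentiable_GDERIV_gradient)
  have D\<phi>: "GDERIV \<phi> x :> D\<phi> x" for x
    unfolding \<phi>_def D\<phi>_def
    by (intro GDERIV_add GDERIV_diff diff GDERIV_norm_square_affine)
  have D: "GDERIV \<psi> x :> D x" for x
    unfolding \<psi>_def D_def dq_def q_def
    by (intro GDERIV_add D\<phi> GDERIV_linear_terms GDERIV_sq_norm_wrt assms(7))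
  obtain c where c: "0 < c" "\<And>u. c * (norm u)\<^sup>2 \<le> u \<bullet> (P *v u)"
    using pos_def_ge_norm_square[OF pos_def_of_Schur_complement[OF assms(7,12,13)]] by metis
  \<comment> \<open>The gradient inequality for \<phi> is added to the exact expansions of
    \<open>q\<close> and of the quadratic; the weight 1/2 of the latter halves
    \<open>c\<close>.\<close>
  have strong: "\<psi> x + D x \<bullet> (z - x) + c / 2 * (norm (z - x))\<^sup>2 \<le> \<psi> z" for x z
  proof -
    have "\<phi> x + D\<phi> x \<bullet> (z - x) \<le> \<phi> z"
      using assms(11) D\<phi> by (intro convex_on_above_gradient) (simp_all add: \<phi>_def)
    moreover have "q z = q x + dq \<bullet> (z - x)"
      by (simp add: q_def dq_def inner_diff_left inner_diff_right matrix_vector_mult_diff_distrib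
          dot_lmul_matrix)
    moreover have "sq_norm_wrt P (z - x\<^sub>k) =
        sq_norm_wrt P (x - x\<^sub>k) + 2 * ((P *v (x - x\<^sub>k)) \<bullet> (z - x)) + sq_norm_wrt P (z - x)"
      using sq_norm_wrt_add[OF assms(7), of "x - x\<^sub>k" "z - x"] by simp
    moreover have "c * (norm (z - x))\<^sup>2 \<le> sq_norm_wrt P (z - x)"
      using c(2) by (simp add: sq_norm_wrt_def)
    ultimately show ?thesis
      by (simp add: \<psi>_def D_def inner_add_left add_divide_distrib)
  qed
  have above: "\<psi> x + D x \<bullet> (z - x) \<le> \<psi> z" for x z
    using strong[of x z] c(1) by (smt (verit) divide_pos_pos mult_nonneg_nonneg zero_le_power2)
  have mem: "(x, y) \<in> T_lin_set f g h A b \<sigma> P Q (x\<^sub>k, y\<^sub>k) \<longleftrightarrow> - D x \<in> subdifferential g x \<and>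
      y = y\<^sub>k + matrix_inv Q *v (b - A *v (2 *\<^sub>R x - x\<^sub>k))" for x y
    unfolding T_lin_set_iff[OF pos_def_invertible[OF assms(12)]] by (simp add: D_def D\<phi>_def dq_def)
  have ex1: "\<exists>!w. w \<in> T_lin_set f g h A b \<sigma> P Q (x\<^sub>k, y\<^sub>k)"
    using strongly_convex_ex1_subdifferential[OF assms(4-6) D _ strong] c(1)
    by (auto simp: Ex1_def mem split_paired_all)
  \<comment> \<open>Only \<open>g\<close> can be infinite, and only positively, so the real terms
    may be collected into \<psi>.\<close>
  have objective: "ereal (f x) + g x - ereal (h x)
      + ereal (gradient h x\<^sub>k \<bullet> (x - x\<^sub>k) - y\<^sub>k \<bullet> (A *v x - b)
        + \<sigma> / 2 * (norm (A *v x - b))\<^sup>2 + 1 / 2 * sq_norm_wrt P (x - x\<^sub>k)) =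
      ereal (\<psi> x) + g x" for x
    using assms(4) by (cases "g x") (auto simp: proper_fun_def \<psi>_def \<phi>_def q_def)
  have "(x', y') = T_lin f g h A b \<sigma> P Q (x\<^sub>k, y\<^sub>k) \<longleftrightarrow>
      (x', y') \<in> T_lin_set f g h A b \<sigma> P Q (x\<^sub>k, y\<^sub>k)"
    using theI'[OF ex1] ex1 unfolding T_lin_def by metis
  with ex1 show ?thesis
    unfolding objective mem arg_min_iff_subdifferential[OF assms(4,6) D above] by blast
qed

end
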